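(* Let $\alpha(u)=(u,f_1(u),f_2(u))$ be a smooth space curve in the Galilean space $\mathbb{G}_3$ and let $\beta(v)=(v,g(v),av)$, with $a\in\mathbb{R}$ and $g$ smooth, be a planar non-isotropic curve, both defined on open intervals. If the (regular) translation surface $$r(u,v)=\alpha(u)+\beta(v)=\bigl(u+v,\;f_1(u)+g(v),\;f_2(u)+av\bigr)$$ has nonzero constant mean curvature $H_0$, then it is a generalized cylinder with non-isotropic rulings whose base curve $\alpha$ satisfies, for some $c\in\mathbb{R}$, the following equation on every interval where $f_2'\neq a$ (up to adding suitable constants to $f_1$ and $f_2$, and with suitable choices of the antiderivatives): $$f_1=cu+H_0^2\left\{\frac12\,(f_2-au)^2\,\zeta(\sigma)-\frac12\int\left[(f_2-au)^2\,\frac{d\zeta(\sigma)}{du}\right]du\right\},$$ where $$\zeta(\sigma)=\int (f_2-au)\,d\sigma\quad\text{for}\quad \sigma=\frac{f_1'-c}{f_2'-a},$$ i.e. $\zeta(\sigma)$, regarded as a function of $u$, is an antiderivative of $(f_2-au)\frac{d\sigma}{du}$.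
   Context: The affine model of the Galilean 3-space $\mathbb{G}_3$ is $\mathbb{R}^3$ with coordinates $(x,y,z)$. A vector is isotropic if its first component is $0$, and non-isotropic otherwise. A curve $\alpha(u)=(u,f_1(u),f_2(u))$ is a space curve if its torsion is nowhere zero, i.e. $f_1''f_2'''-f_1'''f_2''\neq 0$ at every $u$. Curvatures of a surface $r(u_1,u_2)=(x,y,z)$ (with $x_{,i}=\partial x/\partial u_i$, $x_{,ij}=\partial^2x/\partial u_i\partial u_j$, etc.): assume $x_{,i}\ne 0$ for some $i$ at each point (admissibility), and set $$W=\sqrt{(x_{,1}z_{,2}-x_{,2}z_{,1})^2+(x_{,2}y_{,1}-x_{,1}y_{,2})^2},\qquad N=\tfrac1W\bigl(0,\,-x_{,1}z_{,2}+x_{,2}z_{,1},\,x_{,1}y_{,2}-x_{,2}y_{,1}\bigr),$$ where regularity means $W>0$ everywhere, and $$L_{ij}=\tfrac1{x_{,k}}\bigl(x_{,k}(0,y_{,ij},z_{,ij})-x_{,ij}(0,y_{,k},z_{,k})\bigr)\cdot N$$ for an index $k$ with $x_{,k}\neq 0$, where $\cdot$ is the Euclidean scalar product. The mean curvature is normalized as $H=(x_{,2}^2L_{11}-2x_{,1}x_{,2}L_{12}+x_{,1}^2L_{22})/W^2$; for the surface in the claim this is $$H=\frac{(f_2'-a)g''+(f_2'-a)f_1''-(f_1'-g')f_2''}{[(f_2'-a)^2+(f_1'-g')^2]^{3/2}}.$$ A generalized cylinder (cylindrical surface) is a surface that can be parameterized as $\gamma(t)+\lambda e$ with $\gamma$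 a (base) curve and $e\neq 0$ a constant vector; its rulings are non-isotropic if $e$ is non-isotropic. *)

theory Defs
  imports "HOL-Analysis.Analysis"
begin

definition isotropic :: "real ^ 3 \<Rightarrow> bool" where
  "isotropic p \<longleftrightarrow> p $ 1 = 0"

definition graph_curve :: "(real \<Rightarrow> real) \<Rightarrow> (real \<Rightarrow> real) \<Rightarrow> real \<Rightarrow> real ^ 3" where
  "graph_curve f1 f2 u = vector [u, f1 u, f2 u]"

text \<open>Smoothness on an open set of reals: all derivatives exist there.\<close>

definition smooth_fun_on :: "real set \<Rightarrow> (real \<Rightarrow> real) \<Rightarrow> bool" where
  "smooth_fun_on I f \<longleftrightarrow> (\<forall>n. (deriv ^^ n) f differentiable_on I)"

definition smooth_curve_on :: "real set \<Rightarrow> (real \<Rightarrow> real ^ 3) \<Rightarrow> bool" where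
  "smooth_curve_on I \<gamma> \<longleftrightarrow> (\<forall>i. smooth_fun_on I (\<lambda>t. \<gamma> t $ i))"

text \<open>The curve \<open>graph_curve f1 f2\<close> has nowhere zero torsion.\<close>

definition space_curve_on :: "real set \<Rightarrow> (real \<Rightarrow> real) \<Rightarrow> (real \<Rightarrow> real) \<Rightarrow> bool" where
  "space_curve_on I f1 f2 \<longleftrightarrow>
     (\<forall>u\<in>I. (deriv ^^ 2) f1 u * (deriv ^^ 3) f2 u - (deriv ^^ 3) f1 u * (deriv ^^ 2) f2 u \<noteq> 0)"

definition open_interval :: "real set \<Rightarrow> bool" where
  "open_interval I \<longleftrightarrow> open I \<and> is_interval I \<and> I \<noteq> {}"

text \<open>The parameters \<open>(u\<^sub>1, u\<^sub>2)\<close> of a surface form a vector \<open>w :: real ^ 2\<close>, and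
  \<open>partial_deriv i r w\<close> is the derivative of \<open>r\<close> at \<open>w\<close> in the coordinate \<open>u\<^sub>i\<close>.\<close>

definition partial_deriv ::
    "'n::finite \<Rightarrow> (real ^ 'n \<Rightarrow> 'b::real_normed_vector) \<Rightarrow> real ^ 'n \<Rightarrow> 'b" where
  "partial_deriv i r w = vector_derivative (\<lambda>t. r (w + t *\<^sub>R axis i 1)) (at 0)"

definition param_rect :: "real set \<Rightarrow> real set \<Rightarrow> (real ^ 2) set" where
  "param_rect U V = {w. w $ 1 \<in> U \<and> w $ 2 \<in> V}"

definition surf_W :: "(real ^ 2 \<Rightarrow> real ^ 3) \<Rightarrow> real ^ 2 \<Rightarrow> real" where
  "surf_W r w =
     (let x = (\<lambda>i. partial_deriv i r w $ 1);
          y = (\<lambda>i. partial_deriv i r w $ 2);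
          z = (\<lambda>i. partial_deriv i r w $ 3)
      in sqrt ((x 1 * z 2 - x 2 * z 1)\<^sup>2 + (x 2 * y 1 - x 1 * y 2)\<^sup>2))"

definition surf_N :: "(real ^ 2 \<Rightarrow> real ^ 3) \<Rightarrow> real ^ 2 \<Rightarrow> real ^ 3" where
  "surf_N r w =
     (let x = (\<lambda>i. partial_deriv i r w $ 1);
          y = (\<lambda>i. partial_deriv i r w $ 2);
          z = (\<lambda>i. partial_deriv i r w $ 3)
      in (1 / surf_W r w) *\<^sub>R vector [0, - x 1 * z 2 + x 2 * z 1, x 1 * y 2 - x 2 * y 1])"

text \<open>At an admissible point the value does not depend on the choice of \<open>k\<close>.\<close>

definition surf_L :: "(real ^ 2 \<Rightarrow> real ^ 3) \<Rightarrow> 2 \<Rightarrow> 2 \<Rightarrow> real ^ 2 \<Rightarrow> real" where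
  "surf_L r i j w =
     (let k = (SOME k. partial_deriv k r w $ 1 \<noteq> 0);
          d = partial_deriv k r w;
          dd = partial_deriv i (partial_deriv j r) w
      in ((1 / d $ 1) *\<^sub>R (d $ 1 *\<^sub>R vector [0, dd $ 2, dd $ 3]
            - dd $ 1 *\<^sub>R vector [0, d $ 2, d $ 3])) \<bullet> surf_N r w)"

definition mean_curvature :: "(real ^ 2 \<Rightarrow> real ^ 3) \<Rightarrow> real ^ 2 \<Rightarrow> real" where
  "mean_curvature r w =
     (let x = (\<lambda>i. partial_deriv i r w $ 1)
      in ((x 2)\<^sup>2 * surf_L r 1 1 w - 2 * x 1 * x 2 * surf_L r 1 2 w + (x 1)\<^sup>2 * surf_L r 2 2 w)
           / (surf_W r w)\<^sup>2)"

definition regular_surface_on :: "(real ^ 2) set \<Rightarrow> (real ^ 2 \<Rightarrow> real ^ 3) \<Rightarrow> bool" where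
  "regular_surface_on D r \<longleftrightarrow>
     (\<forall>w\<in>D. (\<exists>i. partial_deriv i r w $ 1 \<noteq> 0) \<and> surf_W r w > 0)"

definition translation_surface ::
    "(real \<Rightarrow> real ^ 3) \<Rightarrow> (real \<Rightarrow> real ^ 3) \<Rightarrow> real ^ 2 \<Rightarrow> real ^ 3" where
  "translation_surface \<alpha> \<beta> w = \<alpha> (w $ 1) + \<beta> (w $ 2)"

text \<open>Smoothness on an open set: all iterated partial derivatives are differentiable (hence
  continuous) there.\<close>

definition smooth_map_on ::
    "(real ^ 'n::finite) set \<Rightarrow> (real ^ 'n \<Rightarrow> 'b::real_normed_vector) \<Rightarrow> bool" where
  "smooth_map_on D f \<longleftrightarrow> (\<forall>ks. foldr partial_deriv ks f differentiable_on D)"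

definition diffeo_between ::
    "(real ^ 'n::finite) set \<Rightarrow> (real ^ 'n) set \<Rightarrow> (real ^ 'n \<Rightarrow> real ^ 'n) \<Rightarrow> bool" where
  "diffeo_between D E \<phi> \<longleftrightarrow>
     bij_betw \<phi> D E \<and> smooth_map_on D \<phi> \<and> smooth_map_on E (the_inv_into D \<phi>)"

text \<open>Up to a change of parameters, \<open>r\<close> on \<open>D\<close> is the surface \<open>\<gamma> t + \<lambda> *\<^sub>R e\<close>, where \<open>t\<close> ranges
  over \<open>T\<close> and \<open>\<lambda>\<close> over some open interval.\<close>

definition generalized_cylinder ::
    "(real ^ 2) set \<Rightarrow> (real ^ 2 \<Rightarrow> real ^ 3) \<Rightarrow> real set \<Rightarrow> (real \<Rightarrow> real ^ 3) \<Rightarrow> real ^ 3 \<Rightarrow> bool"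
  where
  "generalized_cylinder D r T \<gamma> e \<longleftrightarrow>
     e \<noteq> 0 \<and> open_interval T \<and> smooth_curve_on T \<gamma> \<and>
     (\<exists>\<Lambda> \<phi>. open_interval \<Lambda> \<and> diffeo_between D (param_rect T \<Lambda>) \<phi> \<and>
        (\<forall>w\<in>D. r w = \<gamma> (\<phi> w $ 1) + (\<phi> w $ 2) *\<^sub>R e))"

definition antiderivative_on :: "real set \<Rightarrow> (real \<Rightarrow> real) \<Rightarrow> (real \<Rightarrow> real) \<Rightarrow> bool" where
  "antiderivative_on J F f \<longleftrightarrow> (\<forall>u\<in>J. (F has_real_derivative f u) (at u))"

end

theory Submission
  imports Defs
begin

text \<open>Put \<open>p = f\<^sub>2' - a\<close>, \<open>q = f\<^sub>1' - g'\<close> and \<open>W = sqrt (p\<^sup>2 + q\<^sup>2)\<close>, so that constant mean curvature reads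
  \<open>p (f\<^sub>1'' + g'') - q f\<^sub>2'' = H\<^sub>0 W\<^sup>3\<close>. For fixed \<open>u\<close> this expresses \<open>g''\<close> through \<open>w = g'\<close>; comparing two
  values of \<open>u\<close> yields an algebraic identity in \<open>w\<close> whose behaviour at infinity forces \<open>p\<^sup>2\<close> to be locally
  constant as soon as \<open>g'\<close> takes infinitely many values. This is excluded by the nonzero torsion, so
  \<open>g'\<close> is a constant \<open>c\<close> and the surface is a cylinder. The equation now says
  \<open>(q / W)' = H\<^sub>0 p\<close>, hence \<open>q = H\<^sub>0 F W\<close> on all of \<open>U\<close> with \<open>F = f\<^sub>2 + k\<^sub>2 - a u\<close>, and where
  \<open>p \<noteq> 0\<close> the function \<open>\<zeta> = W / (H\<^sub>0 p)\<close> satisfies \<open>\<zeta>' = F (q / p)'\<close> and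
  \<open>f\<^sub>1' - c = H\<^sub>0\<^sup>2 F F' \<zeta>\<close>, which integrates by parts to the stated formula.\<close>

section \<open>Smooth functions of one real variable\<close>

lemma smooth_fun_on_has_deriv:
  assumes "open I" "smooth_fun_on I f" "u \<in> I"
  shows "((deriv ^^ n) f has_real_derivative (deriv ^^ Suc n) f u) (at u)"
proof -
  have "(deriv ^^ n) f differentiable (at u)"
    using assms by (simp add: smooth_fun_on_def differentiable_on_eq_differentiable_at)
  then show ?thesis
    by (simp add: DERIV_deriv_iff_real_differentiable)
qed

lemma DERIV_zero_of_constant_on_open:
  fixes f :: "real \<Rightarrow> real"
  assumes "(f has_real_derivative D) (at u)" "open S" "u \<in> S" "\<And>t. t \<in> S \<Longrightarrow> f t = k"
  shows "D = 0"
  using has_field_derivative_transform_within_open[OF assms] DERIV_const DERIV_unique by blast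

lemma smooth_fun_on_add_const:
  assumes "smooth_fun_on I f"
  shows "smooth_fun_on I (\<lambda>t. f t + b)"
  unfolding smooth_fun_on_def
proof
  fix n
  \<comment> \<open>\<open>deriv\<close> is a choice among all \<open>D\<close> that satisfy the
    derivative predicate. Equivalent predicates at every \<open>x\<close> therefore give equal
    functions, even outside \<open>I\<close>, where nothing is known about
    differentiability.\<close>
  have "((\<lambda>t. f t + b) has_real_derivative D) (at x) \<longleftrightarrow> (f has_real_derivative D) (at x)" for x D
  proof
    assume "((\<lambda>t. f t + b) has_real_derivative D) (at x)"
    from DERIV_diff[OF this DERIV_const[of b]]
    show "(f has_real_derivative D) (at x)" by simp
  qed (auto intro!: derivative_eq_intros)
  then  have "deriv (\<lambda>t. f t + b) = deriv f"
    by (simp add: deriv_def fun_eq_iff)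
  then have deriv_eq: "(deriv ^^ Suc m) (\<lambda>t. f t + b) = (deriv ^^ Suc m) f" for m
    by (simp add: funpow_Suc_right del: funpow.simps)
  have f: "(deriv ^^ m) f differentiable_on I" for m
    using assms by (simp add: smooth_fun_on_def)
  show "(deriv ^^ n) (\<lambda>t. f t + b) differentiable_on I"
  proof (cases n)
    case 0
    then show ?thesis using f[of 0] by (simp add: differentiable_on_add)
  next
    case (Suc m)
    show ?thesis unfolding Suc deriv_eq by (rule f)
  qed
qed

lemma smooth_fun_on_mult_left: "smooth_fun_on I (\<lambda>t. a * t)"
  unfolding smooth_fun_on_def
proof
  fix n
  \<comment> \<open>The affine functions are closed under \<open>deriv\<close>, so existence of some
    coefficients is a strong enough induction claim.\<close>
  have "\<exists>s b. (deriv ^^ n) (\<lambda>t. a * t) = (\<lambda>t::real. s * t + b)"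
  proof (induction n)
    case 0
    show ?case by (rule exI[of _ a], rule exI[of _ 0]) auto
  next
    case (Suc n)
    then obtain s b where "(deriv ^^ n) (\<lambda>t. a * t) = (\<lambda>t::real. s * t + b)" by blast
    moreover have "deriv (\<lambda>t::real. s * t + b) = (\<lambda>t. 0 * t + s)"
      by (rule ext, rule DERIV_imp_deriv) (auto intro!: derivative_eq_intros)
    ultimately have "(deriv ^^ Suc n) (\<lambda>t. a * t) = (\<lambda>t::real. 0 * t + s)" by simp
    then show ?case by blast
  qed
  then show "(deriv ^^ n) (\<lambda>t. a * t) differentiable_on I"
    by (auto intro!: derivative_intros)
qed

lemma smooth_curve_on_graph_curve:
  assumes "smooth_fun_on I f" "smooth_fun_on I g"
  shows "smooth_curve_on I (graph_curve f g)"
  using assms by (simp add: smooth_curve_on_def graph_curve_def forall_3 smooth_fun_on_mult_left[of _ 1, simplified])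

section \<open>Partial derivatives and smooth maps on open sets\<close>

lemma open_param_rect:
  assumes "open U" "open V"
  shows "open (param_rect U V)"
proof -
  have "param_rect U V = (\<lambda>w. w $ 1) -` U \<inter> (\<lambda>w. w $ 2) -` V"
    by (auto simp: param_rect_def)
  then show ?thesis
    using assms by (auto intro!: open_Int continuous_open_vimage continuous_intros)
qed

text \<open>For small \<open>t\<close> the point \<open>w + t *\<^sub>R axis i 1\<close> stays in
  \<open>D\<close>, so only values near \<open>w\<close> enter. This gives access to second partial
  derivatives when the first ones are known only on the parameter rectangle.\<close>

lemma partial_deriv_cong_open:
  fixes r :: "real ^ 'n::finite \<Rightarrow> 'b::real_normed_vector"
  assumes "open D" "w \<in> D" "\<And>w. w \<in> D \<Longrightarrow> r w = s w"
  shows "partial_deriv i r w = partial_deriv i s w"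
proof -
  have "\<forall>\<^sub>F w in nhds w. w \<in> D"
    using assms by (simp add: eventually_nhds) blast
  moreover have "((\<lambda>t. w + t *\<^sub>R axis i 1) \<longlongrightarrow> w + 0 *\<^sub>R axis i 1) (nhds (0::real))"
    by (intro tendsto_intros filterlim_ident)
  ultimately have "\<forall>\<^sub>F t in nhds 0. w + t *\<^sub>R axis i 1 \<in> D"
    by (auto simp: filterlim_iff)
  then have "\<forall>\<^sub>F t in nhds 0. r (w + t *\<^sub>R axis i 1) = s (w + t *\<^sub>R axis i 1)"
    by eventually_elim (rule assms)
  then show ?thesis
    unfolding partial_deriv_def by (intro vector_derivative_cong_eq) auto
qed

text \<open>Iterated partial derivatives of the identity remain of the form
  \<open>s *\<^sub>R w + b\<close> on \<open>D\<close>. Agreement with the identity is asked only on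
  \<open>D\<close>, so that the lemma also covers \<open>the_inv_into D\<close>, which is
  unspecified elsewhere.\<close>

lemma smooth_map_on_ident:
  fixes f :: "real ^ 'n::finite \<Rightarrow> real ^ 'n"
  assumes "open D" "\<And>w. w \<in> D \<Longrightarrow> f w = w"
  shows "smooth_map_on D f"
  unfolding smooth_map_on_def
proof
  fix ks
  have "\<exists>s b. \<forall>w\<in>D. foldr partial_deriv ks f w = s *\<^sub>R w + b"
  proof (induction ks)
    case Nil
    have "\<forall>w\<in>D. foldr partial_deriv [] f w = 1 *\<^sub>R w + 0"
      using assms by simp
    then show ?case by blast
  next
    case (Cons k ks)
    then obtain s b where sb: "\<forall>w\<in>D. foldr partial_deriv ks f w = s *\<^sub>R w + b" by blast
    have "foldr partial_deriv (k # ks) f w = 0 *\<^sub>R w + s *\<^sub>R axis k 1" if "w \<in> D" for w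
    proof -
      have "foldr partial_deriv (k # ks) f w = partial_deriv k (\<lambda>w. s *\<^sub>R w + b) w"
        unfolding foldr_Cons comp_apply
        by (rule partial_deriv_cong_open[OF \<open>open D\<close> that]) (use sb in blast)
      also have "\<dots> = s *\<^sub>R axis k 1"
        unfolding partial_deriv_def
        by (rule vector_derivative_at) (auto intro!: derivative_eq_intros)
      finally show ?thesis by simp
    qed
    then show ?case by blast
  qed
  then obtain s b where sb: "\<forall>w\<in>D. foldr partial_deriv ks f w = s *\<^sub>R w + b" by blast
  have "(\<lambda>w. s *\<^sub>R w + b) differentiable_on D"
    by (auto intro!: derivative_intros)
  then show "foldr partial_deriv ks f differentiable_on D"
    unfolding differentiable_on_def
    using sb by (auto intro: differentiable_transform_within[where f = "\<lambda>w. s *\<^sub>R w + b", OF _ zero_less_one])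
qed

lemma diffeo_between_id:
  fixes D :: "(real ^ 'n::finite) set"
  assumes "open D"
  shows "diffeo_between D D (\<lambda>w. w)"
  unfolding diffeo_between_def
  using assms by (auto intro!: smooth_map_on_ident the_inv_into_f_eq simp: bij_betw_def)

section \<open>Mean curvature of translation surfaces\<close>

lemma has_vector_derivative_vector_3:
  assumes "(f has_real_derivative f') (at t)" "(g has_real_derivative g') (at t)"
    "(h has_real_derivative h') (at t)"
  shows "((\<lambda>t. vector [f t, g t, h t] :: real ^ 3) has_vector_derivative vector [f', g', h']) (at t)"
proof -
  have eq: "(vector [x, y, z] :: real ^ 3) = x *\<^sub>R axis 1 1 + y *\<^sub>R axis 2 1 + z *\<^sub>R axis 3 1" for x y z
    by (simp add: vec_eq_iff forall_3 axis_def)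
  show ?thesis
    unfolding eq using assms[unfolded has_real_derivative_iff_has_vector_derivative]
    by (auto intro!: derivative_eq_intros simp: has_real_derivative_iff_has_vector_derivative)
qed

lemma partial_deriv_translation_1:
  assumes "(\<alpha> has_vector_derivative A) (at (w $ 1))"
  shows "partial_deriv 1 (translation_surface \<alpha> \<beta>) w = A"
  unfolding partial_deriv_def translation_surface_def
proof (rule vector_derivative_at)
  have "(\<alpha> \<circ> (\<lambda>t. w $ 1 + t) has_vector_derivative 1 *\<^sub>R A) (at 0)"
    using assms by (intro vector_diff_chain_at) (auto intro!: derivative_eq_intros)
  then show "((\<lambda>t. \<alpha> ((w + t *\<^sub>R axis 1 1) $ 1) + \<beta> ((w + t *\<^sub>R axis 1 1) $ 2)) has_vector_derivative A) (at 0)"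
    by (auto simp: axis_def o_def intro!: derivative_eq_intros)
qed

lemma partial_deriv_translation_2:
  assumes "(\<beta> has_vector_derivative B) (at (w $ 2))"
  shows "partial_deriv 2 (translation_surface \<alpha> \<beta>) w = B"
  unfolding partial_deriv_def translation_surface_def
proof (rule vector_derivative_at)
  have "(\<beta> \<circ> (\<lambda>t. w $ 2 + t) has_vector_derivative 1 *\<^sub>R B) (at 0)"
    using assms by (intro vector_diff_chain_at) (auto intro!: derivative_eq_intros)
  then show "((\<lambda>t. \<alpha> ((w + t *\<^sub>R axis 2 1) $ 1) + \<beta> ((w + t *\<^sub>R axis 2 1) $ 2)) has_vector_derivative B) (at 0)"
    by (auto simp: axis_def o_def intro!: derivative_eq_intros)
qed

text \<open>Both curves carry their parameter as first coordinate. Hence both first partials have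
  first component 1, all second partials are isotropic, and the mixed one vanishes, which leaves the
  sum of \<open>L11\<close> and \<open>L22\<close> over \<open>W^2\<close>.\<close>

lemma mean_curvature_translation_graph_curves:
  fixes f1 f2 g1 g2 :: "real \<Rightarrow> real"
  defines "r \<equiv> translation_surface (graph_curve f1 f2) (graph_curve g1 g2)"
  assumes "open U" "open V" "u \<in> U" "v \<in> V"
    and f: "smooth_fun_on U f1" "smooth_fun_on U f2"
    and g: "smooth_fun_on V g1" "smooth_fun_on V g2"
  defines "p \<equiv> deriv f2 u - deriv g2 v" and "q \<equiv> deriv f1 u - deriv g1 v"
  shows "surf_W r (vector [u, v]) = sqrt (p\<^sup>2 + q\<^sup>2)" (is ?W)
    and "mean_curvature r (vector [u, v]) =
      (p * (deriv (deriv f1) u + deriv (deriv g1) v) - q * (deriv (deriv f2) u + deriv (deriv g2) v))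
        / sqrt (p\<^sup>2 + q\<^sup>2) ^ 3" (is ?H)
proof -
  let ?D = "param_rect U V" and ?w = "vector [u, v] :: real ^ 2"
  define \<alpha> where "\<alpha> = (\<lambda>u. vector [1, deriv f1 u, deriv f2 u] :: real ^ 3)"
  define \<beta> where "\<beta> = (\<lambda>u. vector [1, deriv g1 u, deriv g2 u] :: real ^ 3)"
  have D: "open ?D" "?w \<in> ?D"
    using assms open_param_rect[of U V] by (auto simp: param_rect_def)
  have d: "((deriv ^^ 0) F has_real_derivative (deriv ^^ Suc 0) F t) (at t)"
     "((deriv ^^ Suc 0) F has_real_derivative (deriv ^^ Suc (Suc 0)) F t) (at t)"
    if "smooth_fun_on I F" "open I" "t \<in> I" for I F t
    using that by (blast intro: smooth_fun_on_has_deriv)+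
  have fd: "(f1 has_real_derivative deriv f1 t) (at t)" "(f2 has_real_derivative deriv f2 t) (at t)"
    "(deriv f1 has_real_derivative deriv (deriv f1) t) (at t)"
    "(deriv f2 has_real_derivative deriv (deriv f2) t) (at t)" if "t \<in> U" for t
    using d[OF f(1) \<open>open U\<close> that] d[OF f(2) \<open>open U\<close> that] by simp_all
  have gd: "(g1 has_real_derivative deriv g1 t) (at t)" "(g2 has_real_derivative deriv g2 t) (at t)"
    "(deriv g1 has_real_derivative deriv (deriv g1) t) (at t)"
    "(deriv g2 has_real_derivative deriv (deriv g2) t) (at t)" if "t \<in> V" for t
    using d[OF g(1) \<open>open V\<close> that] d[OF g(2) \<open>open V\<close> that] by simp_all
  \<comment> \<open>Each first partial is again a translation surface, with one summand zero, so the
    same two lemmas yield the second partials.\<close>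
  have r1: "partial_deriv 1 r w = translation_surface \<alpha> (\<lambda>_. 0) w" if "w \<in> ?D" for w
    unfolding r_def
    by (subst partial_deriv_translation_1[where A = "\<alpha> (w $ 1)"])
      (use that fd in \<open>auto simp: graph_curve_def[abs_def] \<alpha>_def param_rect_def translation_surface_def
        intro!: has_vector_derivative_vector_3\<close>)
  have r2: "partial_deriv 2 r w = translation_surface (\<lambda>_. 0) \<beta> w" if "w \<in> ?D" for w
    unfolding r_def
    by (subst partial_deriv_translation_2[where B = "\<beta> (w $ 2)"])
      (use that gd in \<open>auto simp: graph_curve_def[abs_def] \<beta>_def param_rect_def translation_surface_def
        intro!: has_vector_derivative_vector_3\<close>)
  have r11: "partial_deriv 1 (partial_deriv 1 r) ?w = vector [0, deriv (deriv f1) u, deriv (deriv f2) u]"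
  proof -
    have "partial_deriv 1 (partial_deriv 1 r) ?w = partial_deriv 1 (translation_surface \<alpha> (\<lambda>_. 0)) ?w"
      by (rule partial_deriv_cong_open[OF D]) (rule r1)
    also have "\<dots> = vector [0, deriv (deriv f1) u, deriv (deriv f2) u]"
      by (rule partial_deriv_translation_1)
        (use fd \<open>u \<in> U\<close> in \<open>auto simp: \<alpha>_def intro!: has_vector_derivative_vector_3\<close>)
    finally show ?thesis .
  qed
  have r12: "partial_deriv 1 (partial_deriv 2 r) ?w = 0"
  proof -
    have "partial_deriv 1 (partial_deriv 2 r) ?w = partial_deriv 1 (translation_surface (\<lambda>_. 0) \<beta>) ?w"
      by (rule partial_deriv_cong_open[OF D]) (rule r2)
    also have "\<dots> = 0"
      by (rule partial_deriv_translation_1) auto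
    finally show ?thesis .
  qed
  have r22: "partial_deriv 2 (partial_deriv 2 r) ?w = vector [0, deriv (deriv g1) v, deriv (deriv g2) v]"
  proof -
    have "partial_deriv 2 (partial_deriv 2 r) ?w = partial_deriv 2 (translation_surface (\<lambda>_. 0) \<beta>) ?w"
      by (rule partial_deriv_cong_open[OF D]) (rule r2)
    also have "\<dots> = vector [0, deriv (deriv g1) v, deriv (deriv g2) v]"
      by (rule partial_deriv_translation_2)
        (use gd \<open>v \<in> V\<close> in \<open>auto simp: \<beta>_def intro!: has_vector_derivative_vector_3\<close>)
    finally show ?thesis .
  qed
  have d1: "partial_deriv 1 r ?w = vector [1, deriv f1 u, deriv f2 u]"
    and d2: "partial_deriv 2 r ?w = vector [1, deriv g1 v, deriv g2 v]"
    using r1[OF D(2)] r2[OF D(2)] by (simp_all add: translation_surface_def \<alpha>_def \<beta>_def)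
  show W: ?W
    by (simp add: surf_W_def d1 d2 p_def q_def power2_commute)
  have N: "surf_N r ?w = (1 / sqrt (p\<^sup>2 + q\<^sup>2)) *\<^sub>R vector [0, p, - q]"
    by (simp add: surf_N_def W d1 d2) (simp add: p_def q_def)
  \<comment> \<open>This makes the index chosen by \<open>SOME\<close> in \<open>surf_L\<close>
    irrelevant: the term with \<open>dd $ 1\<close> drops out and the division is by 1.\<close>
  have "\<forall>k. partial_deriv k r ?w $ 1 = 1"
    by (simp add: forall_2 d1 d2)
  then have L: "surf_L r i j ?w = vector [0, partial_deriv i (partial_deriv j r) ?w $ 2,
        partial_deriv i (partial_deriv j r) ?w $ 3] \<bullet> surf_N r ?w"
    if "partial_deriv i (partial_deriv j r) ?w $ 1 = 0" for i j
    using that by (simp add: surf_L_def Let_def)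
  have L11: "surf_L r 1 1 ?w = (p * deriv (deriv f1) u - q * deriv (deriv f2) u) / sqrt (p\<^sup>2 + q\<^sup>2)"
    and L12: "surf_L r 1 2 ?w = 0"
    and L22: "surf_L r 2 2 ?w = (p * deriv (deriv g1) v - q * deriv (deriv g2) v) / sqrt (p\<^sup>2 + q\<^sup>2)"
    by (simp_all add: L r11 r12 r22 N inner_vec_def sum_3 diff_divide_distrib mult.commute)
  have "mean_curvature r ?w = (surf_L r 1 1 ?w + surf_L r 2 2 ?w) / (sqrt (p\<^sup>2 + q\<^sup>2))\<^sup>2"
    unfolding mean_curvature_def Let_def d1 d2 W L12 by simp
  moreover have "(x / y + z / y) / y\<^sup>2 = (x + z) / y ^ 3" for x y z :: real
    by (simp add: add_divide_distrib power2_eq_square power3_eq_cube)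
  ultimately have "mean_curvature r ?w = (p * deriv (deriv f1) u - q * deriv (deriv f2) u
      + (p * deriv (deriv g1) v - q * deriv (deriv g2) v)) / sqrt (p\<^sup>2 + q\<^sup>2) ^ 3"
    unfolding L11 L22 by (simp only:)
  moreover have "p * deriv (deriv f1) u - q * deriv (deriv f2) u + (p * deriv (deriv g1) v - q * deriv (deriv g2) v)
      = p * (deriv (deriv f1) u + deriv (deriv g1) v) - q * (deriv (deriv f2) u + deriv (deriv g2) v)"
    by (simp add: algebra_simps)
  ultimately show ?H by (simp only:)
qed

section \<open>Algebra of the curvature equation and constancy of g'\<close>

text \<open>Squaring twice turns the hypothesis into a polynomial identity of degree 12 in \<open>w\<close>; its
  leading coefficients satisfy \<open>4 a\<^sub>1 a\<^sub>2 = (a\<^sub>1 + a\<^sub>2)\<^sup>2\<close> with \<open>a\<^sub>i = h\<^sup>2 / p\<^sub>i\<^sup>2\<close>.\<close>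

lemma three_halves_powers_diff_affine:
  fixes p1 p2 m1 m2 h A B :: real
  assumes nz: "p1 \<noteq> 0" "p2 \<noteq> 0" "h \<noteq> 0" and S: "infinite S"
    and eq: "\<And>w. w \<in> S \<Longrightarrow>
      h * sqrt (p1\<^sup>2 + (m1 - w)\<^sup>2) ^ 3 / p1 - h * sqrt (p2\<^sup>2 + (m2 - w)\<^sup>2) ^ 3 / p2 = A + B * w"
  shows "p1\<^sup>2 = p2\<^sup>2"
proof -
  define a where "a p = h\<^sup>2 / p\<^sup>2" for p
  define P where "P p m = smult (a p) ([:p\<^sup>2 + m\<^sup>2, - 2 * m, 1:] ^ 3)" for p m
  define Q where "Q = [:A, B:]"
  \<comment> \<open>Let \<open>x\<close>, \<open>y\<close> be the two radical terms at
    \<open>w\<close> in \<open>S\<close>. There \<open>P\<close> takes the values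
    \<open>x^2\<close>, \<open>y^2\<close> and \<open>Q\<close> is \<open>x - y\<close>, so
    \<open>P p1 m1 + P p2 m2 - Q^2\<close> is \<open>2 * x * y\<close> and \<open>R\<close>
    vanishes.\<close>
  define R where "R = 4 * P p1 m1 * P p2 m2 - (P p1 m1 + P p2 m2 - Q\<^sup>2)\<^sup>2"
  have P: "poly (P p m) w = (h * sqrt (p\<^sup>2 + (m - w)\<^sup>2) ^ 3 / p)\<^sup>2" for p m w
  proof -
    have "(sqrt (p\<^sup>2 + (m - w)\<^sup>2) ^ 3)\<^sup>2 = (p\<^sup>2 + (m - w)\<^sup>2) ^ 3"
      by (metis (no_types) power_commutes power_mult mult.commute real_sqrt_pow2 sum_power2_ge_zero)
    then show ?thesis
      by (simp add: P_def a_def power_mult_distrib power_divide)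
        (simp add: power2_eq_square algebra_simps)
  qed
  have "poly R w = 0" if "w \<in> S" for w
  proof -
    have "4 * x\<^sup>2 * y\<^sup>2 - (x\<^sup>2 + y\<^sup>2 - (x - y)\<^sup>2)\<^sup>2 = 0" for x y :: real
      by (simp add: power2_eq_square algebra_simps)
    then show ?thesis
      using eq[OF that] by (simp add: R_def P Q_def mult.commute)
  qed
  \<comment> \<open>Infinitely many roots force the zero polynomial. The identity thus leaves
    \<open>S\<close>, which may be bounded, and \<open>w\<close> can tend to infinity.\<close>
  then have "R = 0"
    using S poly_roots_finite[of R] by (metis (mono_tags, lifting) finite_subset mem_Collect_eq subsetI)
  then have R0: "4 * (poly (P p1 m1) w / w ^ 6) * (poly (P p2 m2) w / w ^ 6)
      - (poly (P p1 m1) w / w ^ 6 + poly (P p2 m2) w / w ^ 6 - ((A + B * w) / w ^ 3)\<^sup>2)\<^sup>2 = 0"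
    if "w > 0" for w
  proof -
    have "4 * (x / z\<^sup>2) * (y / z\<^sup>2) - (x / z\<^sup>2 + y / z\<^sup>2 - (q / z)\<^sup>2)\<^sup>2
        = (4 * x * y - (x + y - q\<^sup>2)\<^sup>2) / z ^ 4" if "z \<noteq> 0" for x y z q :: real
    proof -
      have *: "x / z\<^sup>2 + y / z\<^sup>2 - (q / z)\<^sup>2 = (x + y - q\<^sup>2) / z\<^sup>2"
        by (simp add: power_divide diff_divide_distrib add_divide_distrib)
      show ?thesis
        unfolding * by (rule trans[OF _ diff_divide_distrib[symmetric]])
          (simp add: power_divide flip: power_mult power_add)
    qed
    from this[of "w ^ 3" "poly (P p1 m1) w" "poly (P p2 m2) w" "poly Q w"]
    have "4 * (poly (P p1 m1) w / w ^ 6) * (poly (P p2 m2) w / w ^ 6)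
      - (poly (P p1 m1) w / w ^ 6 + poly (P p2 m2) w / w ^ 6 - (poly Q w / w ^ 3)\<^sup>2)\<^sup>2
      = poly R w / (w ^ 3) ^ 4"
      using that by (simp add: R_def flip: power_mult)
    then show ?thesis
      by (simp add: \<open>R = 0\<close> Q_def mult.commute)
  qed
  have lim: "((\<lambda>w. poly (P p m) w / w ^ 6) \<longlongrightarrow> a p) at_top" for p m
  proof -
    have "((\<lambda>w. a p * ((p\<^sup>2 + m\<^sup>2) * inverse w ^ 2 - 2 * m * inverse w + 1) ^ 3)
        \<longlongrightarrow> a p * ((p\<^sup>2 + m\<^sup>2) * 0 ^ 2 - 2 * m * 0 + 1) ^ 3) at_top"
      by (intro tendsto_intros tendsto_inverse_0_at_top filterlim_ident)
    moreover have "\<forall>\<^sub>F w in at_top. a p * ((p\<^sup>2 + m\<^sup>2) * inverse w ^ 2 - 2 * m * inverse w + 1) ^ 3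
        = poly (P p m) w / w ^ 6"
      using eventually_gt_at_top[of 0]
    proof eventually_elim
      case (elim w)
      then have "(p\<^sup>2 + m\<^sup>2) * inverse w ^ 2 - 2 * m * inverse w + 1
          = poly [:p\<^sup>2 + m\<^sup>2, - 2 * m, 1:] w / w ^ 2"
        by (simp add: field_simps power2_eq_square)
      moreover have "w ^ 6 = (w ^ 2) ^ 3"
        by (simp flip: power_mult)
      ultimately show ?case
        by (simp only: P_def poly_smult poly_power power_divide times_divide_eq_right)
    qed
    ultimately show ?thesis
      by (auto intro: Lim_transform_eventually)
  qed
  \<comment> \<open>\<open>Q^2\<close> has degree at most 2, while the \<open>P\<close> terms have
    degree 6, so it disappears in the limit and only the leading coefficients remain.\<close>
  have limQ: "((\<lambda>w. (A + B * w) / w ^ 3) \<longlongrightarrow> 0) at_top"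
  proof -
    have "((\<lambda>w. A * inverse w ^ 3 + B * inverse w ^ 2) \<longlongrightarrow> A * 0 ^ 3 + B * 0 ^ 2) at_top"
      by (intro tendsto_intros tendsto_inverse_0_at_top filterlim_ident)
    moreover have "\<forall>\<^sub>F w in at_top. A * inverse w ^ 3 + B * inverse w ^ 2 = (A + B * w) / w ^ 3"
      using eventually_gt_at_top[of 0]
      by eventually_elim (simp add: field_simps power2_eq_square power3_eq_cube)
    ultimately show ?thesis
      by (auto intro: Lim_transform_eventually)
  qed
  have "((\<lambda>w. 0) \<longlongrightarrow> 4 * a p1 * a p2 - (a p1 + a p2 - 0\<^sup>2)\<^sup>2) (at_top :: real filter)"
  proof (rule Lim_transform_eventually)
    show "\<forall>\<^sub>F w in at_top. 4 * (poly (P p1 m1) w / w ^ 6) * (poly (P p2 m2) w / w ^ 6)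
      - (poly (P p1 m1) w / w ^ 6 + poly (P p2 m2) w / w ^ 6 - ((A + B * w) / w ^ 3)\<^sup>2)\<^sup>2 = 0"
      using eventually_gt_at_top[of 0] by eventually_elim (rule R0)
  qed (intro tendsto_intros lim limQ)
  then have "4 * a p1 * a p2 - (a p1 + a p2)\<^sup>2 = 0"
    by (simp add: tendsto_const_iff)
  then have "(a p1 - a p2)\<^sup>2 = 0"
    by (simp add: power2_eq_square algebra_simps)
  then show ?thesis
    using nz by (simp add: a_def field_simps)
qed

text \<open>The image of the interval \<open>V\<close> under g' is connected, so it is a single
  point unless it is infinite. An infinite image makes \<open>p^2\<close> constant where
  \<open>p\<close> is nonzero, hence f2'' zero on a nonempty open set, against the torsion
  condition.\<close>

lemma deriv_constant_of_curvature_equation: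
  fixes f1 f2 g :: "real \<Rightarrow> real"
  assumes "open U" "U \<noteq> {}" "open_interval V"
    and sm: "smooth_fun_on U f1" "smooth_fun_on U f2" "smooth_fun_on V g"
    and sc: "space_curve_on U f1 f2" and "H0 \<noteq> 0"
    and eq: "\<And>u v. u \<in> U \<Longrightarrow> v \<in> V \<Longrightarrow>
      (deriv f2 u - a) * (deriv (deriv f1) u + deriv (deriv g) v)
        - (deriv f1 u - deriv g v) * deriv (deriv f2) u
      = H0 * sqrt ((deriv f2 u - a)\<^sup>2 + (deriv f1 u - deriv g v)\<^sup>2) ^ 3"
  obtains c where "\<And>v. v \<in> V \<Longrightarrow> deriv g v = c"
proof -
  define p where "p u = deriv f2 u - a" for u
  have dp: "(p has_real_derivative deriv (deriv f2) u) (at u)"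
    and ddp: "(deriv (deriv f2) has_real_derivative (deriv ^^ 3) f2 u) (at u)" if "u \<in> U" for u
    using smooth_fun_on_has_deriv[OF \<open>open U\<close> sm(2) that, of 1]
      smooth_fun_on_has_deriv[OF \<open>open U\<close> sm(2) that, of 2] unfolding p_def
    by (auto intro!: derivative_eq_intros simp: numeral_2_eq_2 numeral_3_eq_3)
  \<comment> \<open>If f2'' vanishes on an open set then so does f2''', and both terms of the
    torsion expression are zero.\<close>
  have not_zero: False if "open S" "S \<noteq> {}" "S \<subseteq> U" "\<And>u. u \<in> S \<Longrightarrow> deriv (deriv f2) u = 0" for S
  proof -
    obtain u where u: "u \<in> S" "u \<in> U" using \<open>S \<noteq> {}\<close> \<open>S \<subseteq> U\<close> by blast
    have "(deriv ^^ 3) f2 u = 0"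
      by (rule DERIV_zero_of_constant_on_open[OF ddp[OF u(2)] that(1) u(1) that(4)])
    then show False
      using sc u that(4)[OF u(1)] by (auto simp: space_curve_on_def numeral_2_eq_2)
  qed
  have const: False if inf: "infinite (deriv g ` V)"
  proof -
    have sq: "(p u1)\<^sup>2 = (p u2)\<^sup>2" if u: "u1 \<in> U" "u2 \<in> U" "p u1 \<noteq> 0" "p u2 \<noteq> 0" for u1 u2
    proof -
      \<comment> \<open>These are the coefficients after division of the curvature equation by
        \<open>p u\<close>. The term g'' is the same for \<open>u1\<close> and \<open>u2\<close>, so
        subtraction removes it and leaves an affine function of g'.\<close>
      define A where "A = (\<lambda>u. deriv (deriv f1) u - deriv f1 u * deriv (deriv f2) u / p u)"
      define B where "B = (\<lambda>u. deriv (deriv f2) u / p u)"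
      have *: "H0 * sqrt ((p u)\<^sup>2 + (deriv f1 u - deriv g v)\<^sup>2) ^ 3 / p u
          = deriv (deriv g) v + A u + B u * deriv g v" if "u \<in> U" "v \<in> V" "p u \<noteq> 0" for u v
        unfolding eq[OF that(1,2), folded p_def, symmetric] using that(3)
        by (simp add: A_def B_def field_simps)
      show ?thesis
      proof (rule three_halves_powers_diff_affine[OF u(3,4) \<open>H0 \<noteq> 0\<close> inf])
        fix w assume "w \<in> deriv g ` V"
        then obtain v where v: "v \<in> V" and w: "w = deriv g v" by blast
        show "H0 * sqrt ((p u1)\<^sup>2 + (deriv f1 u1 - w)\<^sup>2) ^ 3 / p u1
          - H0 * sqrt ((p u2)\<^sup>2 + (deriv f1 u2 - w)\<^sup>2) ^ 3 / p u2
          = (A u1 - A u2) + (B u1 - B u2) * w"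
          unfolding w *[OF u(1) v u(3)] *[OF u(2) v u(4)] by (simp add: algebra_simps)
      qed
    qed
    have cont: "continuous_on U p"
      by (rule DERIV_continuous_on[OF has_field_derivative_at_within[OF dp]])
    define S where "S = {u \<in> U. p u \<noteq> 0}"
    have "S = p -` (- {0}) \<inter> U" by (auto simp: S_def)
    then have "open S"
      using continuous_open_preimage[OF cont \<open>open U\<close>, of "- {0}"] by (simp add: Int_commute open_Compl)
    have "S \<noteq> {}"
    proof
      assume "S = {}"
      then have p0: "p u = 0" if "u \<in> U" for u using that by (auto simp: S_def)
      have "deriv (deriv f2) u = 0" if "u \<in> U" for u
        by (rule DERIV_zero_of_constant_on_open[OF dp[OF that] \<open>open U\<close> that p0])
      then show False using not_zero[of U] \<open>open U\<close> \<open>U \<noteq> {}\<close> by blast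
    qed
    then obtain u0 where u0: "u0 \<in> S" by blast
    have ddf2: "deriv (deriv f2) u = 0" if "u \<in> S" for u
    proof -
      have "((\<lambda>t. (p t)\<^sup>2) has_real_derivative 2 * p u * deriv (deriv f2) u) (at u)"
        using DERIV_power[OF dp, of u 2] that by (simp add: S_def mult_ac)
      moreover have "(p t)\<^sup>2 = (p u0)\<^sup>2" if "t \<in> S" for t
        using sq that u0 by (auto simp: S_def)
      ultimately have "2 * p u * deriv (deriv f2) u = 0"
        by (rule DERIV_zero_of_constant_on_open[OF _ \<open>open S\<close> that])
      then show ?thesis
        using that by (auto simp: S_def)
    qed
    have "S \<subseteq> U"
      by (auto simp: S_def)
    then show False
      by (rule not_zero[OF \<open>open S\<close> \<open>S \<noteq> {}\<close> _ ddf2])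
  qed
  have "open V" "V \<noteq> {}" "connected V"
    using assms(3) by (auto simp: open_interval_def is_interval_connected)
  have "continuous_on V (deriv g)"
    using smooth_fun_on_has_deriv[OF \<open>open V\<close> sm(3), of _ 1]
    by (intro DERIV_continuous_on[OF has_field_derivative_at_within]) simp
  then have "connected (deriv g ` V)"
    using \<open>connected V\<close> connected_continuous_image by blast
  moreover have "deriv g ` V \<noteq> {}"
    using \<open>V \<noteq> {}\<close> by simp
  ultimately obtain c where c: "deriv g ` V = {c}"
    using const connected_finite_iff_sing by meson
  show thesis
  proof (rule that)
    fix v assume "v \<in> V"
    then have "deriv g v \<in> deriv g ` V" by (rule imageI)
    then show "deriv g v = c" unfolding c by simp
  qed
qed

section \<open>The cylinder and its base curve\<close>

theorem theorem5p3:
  fixes U V :: "real set" and f1 f2 g :: "real \<Rightarrow> real" and a H0 :: real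
  defines "r \<equiv> translation_surface (graph_curve f1 f2) (graph_curve g (\<lambda>v. a * v))"
  assumes "open_interval U" and "open_interval V"
    and "smooth_fun_on U f1" and "smooth_fun_on U f2" and "smooth_fun_on V g"
    and "space_curve_on U f1 f2"
    and "regular_surface_on (param_rect U V) r"
    and "H0 \<noteq> 0"
    and "\<forall>w\<in>param_rect U V. mean_curvature r w = H0"
  shows "(\<exists>e b1 b2. \<not> isotropic e \<and>
            generalized_cylinder (param_rect U V) r
              U (graph_curve (\<lambda>u. f1 u + b1) (\<lambda>u. f2 u + b2)) e) \<and>
         (\<exists>c k1 k2. \<forall>J. is_interval J \<and> J \<subseteq> U \<and> (\<forall>u\<in>J. deriv f2 u \<noteq> a) \<longrightarrow>
            (let F = (\<lambda>u. f2 u + k2 - a * u);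
                 \<sigma> = (\<lambda>u. (deriv f1 u - c) / (deriv f2 u - a))
             in \<exists>\<zeta> P. antiderivative_on J \<zeta> (\<lambda>u. F u * deriv \<sigma> u) \<and>
                      antiderivative_on J P (\<lambda>u. (F u)\<^sup>2 * deriv \<zeta> u) \<and>
                      (\<forall>u\<in>J. f1 u + k1 =
                         c * u + H0\<^sup>2 * (1 / 2 * (F u)\<^sup>2 * \<zeta> u - 1 / 2 * P u))))"
proof -
  have U: "open U" "U \<noteq> {}" "convex U" and V: "open V" "V \<noteq> {}" "convex V"
    using assms(2,3) by (auto simp: open_interval_def is_interval_convex_1)
  have deriv_linear: "deriv (\<lambda>v. a * v) = (\<lambda>_. a)"
    by (rule ext, rule DERIV_imp_deriv) (auto intro!: derivative_eq_intros)
  have "smooth_fun_on V (\<lambda>v. a * v)"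
    by (rule smooth_fun_on_mult_left)
  note H = mean_curvature_translation_graph_curves[OF U(1) V(1) _ _ assms(4,5,6) this,
      unfolded deriv_linear deriv_const add_0_right, folded r_def]
  have W_pos: "sqrt ((deriv f2 u - a)\<^sup>2 + (deriv f1 u - deriv g v)\<^sup>2) > 0"
    and H_eq: "(deriv f2 u - a) * (deriv (deriv f1) u + deriv (deriv g) v)
        - (deriv f1 u - deriv g v) * deriv (deriv f2) u
      = H0 * sqrt ((deriv f2 u - a)\<^sup>2 + (deriv f1 u - deriv g v)\<^sup>2) ^ 3"
    if "u \<in> U" "v \<in> V" for u v
  proof -
    have w: "vector [u, v] \<in> param_rect U V"
      using that by (simp add: param_rect_def)
    show W: "sqrt ((deriv f2 u - a)\<^sup>2 + (deriv f1 u - deriv g v)\<^sup>2) > 0"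
      using assms(8) w unfolding regular_surface_on_def H(1)[OF that, symmetric] by blast
    have "mean_curvature r (vector [u, v]) = H0"
      using assms(10) w by blast
    note H_eq = this[unfolded H(2)[OF that]]
    have "sqrt ((deriv f2 u - a)\<^sup>2 + (deriv f1 u - deriv g v)\<^sup>2) ^ 3 \<noteq> 0"
      using W by (intro power_not_zero) linarith
    from iffD1[OF nonzero_divide_eq_eq[OF this] H_eq]
    show "(deriv f2 u - a) * (deriv (deriv f1) u + deriv (deriv g) v)
        - (deriv f1 u - deriv g v) * deriv (deriv f2) u
      = H0 * sqrt ((deriv f2 u - a)\<^sup>2 + (deriv f1 u - deriv g v)\<^sup>2) ^ 3" .
  qed
  obtain c where c: "\<And>v. v \<in> V \<Longrightarrow> deriv g v = c"
    by (rule deriv_constant_of_curvature_equation[OF U(1,2) assms(3-7,9) H_eq]) (assumption | rule that)+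
  have dg: "(g has_real_derivative c) (at v)" "deriv (deriv g) v = 0" if "v \<in> V" for v
  proof -
    show "(g has_real_derivative c) (at v)"
      using smooth_fun_on_has_deriv[OF V(1) assms(6) that, of 0] c[OF that] by simp
    have *: "(deriv g has_real_derivative deriv (deriv g) v) (at v)"
      using smooth_fun_on_has_deriv[OF V(1) assms(6) that, of 1] by simp
    show "deriv (deriv g) v = 0"
      by (rule DERIV_zero_of_constant_on_open[OF * V(1) that c])
  qed
  have "\<exists>d. \<forall>v\<in>V. g v - c * v = d"
  proof (rule has_field_derivative_zero_constant[OF V(3)])
    fix v assume "v \<in> V"
    then show "((\<lambda>v. g v - c * v) has_real_derivative 0) (at v within V)"
      by (auto intro!: derivative_eq_intros has_field_derivative_at_within[OF dg(1)])
  qed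
  then obtain d where d: "\<And>v. v \<in> V \<Longrightarrow> g v = c * v + d"
    by (auto simp: algebra_simps)
  \<comment> \<open>Since \<open>g v = c * v + d\<close>, the surface is affine in \<open>v\<close>
    with direction \<open>(1, c, a)\<close>. The intercept \<open>d\<close> moves into the base
    curve, and the change of parameters is the identity.\<close>
  have "generalized_cylinder (param_rect U V) r
      U (graph_curve (\<lambda>u. f1 u + d) (\<lambda>u. f2 u + 0)) (vector [1, c, a])"
    unfolding generalized_cylinder_def
  proof (intro conjI exI ballI)
    show "vector [1, c, a] \<noteq> (0 :: real ^ 3)"
      by (simp add: vec_eq_iff forall_3)
    show "smooth_curve_on U (graph_curve (\<lambda>u. f1 u + d) (\<lambda>u. f2 u + 0))"
      by (intro smooth_curve_on_graph_curve smooth_fun_on_add_const assms)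
    show "diffeo_between (param_rect U V) (param_rect U V) (\<lambda>w. w)"
      by (intro diffeo_between_id open_param_rect U V)
    fix w assume "w \<in> param_rect U V"
    then show "r w = graph_curve (\<lambda>u. f1 u + d) (\<lambda>u. f2 u + 0) (w $ 1) + w $ 2 *\<^sub>R vector [1, c, a]"
      using d by (simp add: r_def translation_surface_def graph_curve_def param_rect_def
          vec_eq_iff forall_3 mult.commute)
  qed (fact assms)+
  moreover have "\<not> isotropic (vector [1, c, a])"
    by (simp add: isotropic_def)
  moreover

  \<comment> \<open>Integration of the curvature equation along the base curve\<close>
  define p q W where "p = (\<lambda>u. deriv f2 u - a)" and "q = (\<lambda>u. deriv f1 u - c)"
    and "W = (\<lambda>u. sqrt ((p u)\<^sup>2 + (q u)\<^sup>2))"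
  define p' q' where "p' = deriv (deriv f2)" and "q' = deriv (deriv f1)"
  have df: "(f1 has_real_derivative q u + c) (at u)" "(f2 has_real_derivative p u + a) (at u)"
    "(q has_real_derivative q' u) (at u)" "(p has_real_derivative p' u) (at u)" if "u \<in> U" for u
    using smooth_fun_on_has_deriv[OF U(1) assms(4) that, of 0] smooth_fun_on_has_deriv[OF U(1) assms(5) that, of 0]
      smooth_fun_on_has_deriv[OF U(1) assms(4) that, of 1] smooth_fun_on_has_deriv[OF U(1) assms(5) that, of 1]
    by (auto simp: p_def q_def p'_def q'_def intro!: derivative_eq_intros)
  \<comment> \<open>Any point of the nonempty \<open>V\<close> may be inserted: g' is
    \<open>c\<close> and g'' is 0 there, so an ordinary differential equation in \<open>u\<close>
    alone remains.\<close>
  have W: "W u > 0" "p u * q' u - q u * p' u = H0 * W u ^ 3" if "u \<in> U" for u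
    using V(2) W_pos[OF that] H_eq[OF that] c dg(2)
    by (auto simp: p_def q_def p'_def q'_def W_def)
  have W2: "(W u)\<^sup>2 = (p u)\<^sup>2 + (q u)\<^sup>2" for u
    by (simp add: W_def)
  have dW: "(W has_real_derivative (p u * p' u + q u * q' u) / W u) (at u)" if "u \<in> U" for u
  proof -
    have deriv: "((\<lambda>u. (p u)\<^sup>2 + (q u)\<^sup>2) has_real_derivative 2 * (p u * p' u + q u * q' u)) (at u)"
      by (auto intro!: derivative_eq_intros df that simp: algebra_simps)
    have pos: "(p u)\<^sup>2 + (q u)\<^sup>2 > 0"
      using W(1)[OF that] by (simp add: W_def)
    have "inverse x / 2 * (2 * y) = y / x" for x y :: real
      by (simp add: inverse_eq_divide)
    from DERIV_chain2[OF DERIV_real_sqrt[OF pos] deriv, unfolded this]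
    show ?thesis
      unfolding W_def .
  qed
  have "\<exists>K. \<forall>u\<in>U. q u / W u - H0 * (f2 u - a * u) = K"
  proof (rule has_field_derivative_zero_constant[OF U(3)])
    fix u assume u: "u \<in> U"
    \<comment> \<open>This is the numerator of the derivative of \<open>q / W\<close>.
      Multiplication by \<open>W\<close> clears the inner fraction, and
      \<open>W^2 = p^2 + q^2\<close> brings out the left side of the curvature equation.\<close>
    have "q' u * W u - q u * ((p u * p' u + q u * q' u) / W u) = H0 * p u * (W u)\<^sup>2"
    proof -
      have "(q' u * W u - q u * ((p u * p' u + q u * q' u) / W u)) * W u
        = q' u * (W u)\<^sup>2 - q u * (p u * p' u + q u * q' u)"
        using W(1)[OF u] by (simp add: field_simps power2_eq_square)
      also have "\<dots> = p u * (p u * q' u - q u * p' u)"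
        unfolding W2 by (simp add: power2_eq_square algebra_simps)
      also have "\<dots> = (H0 * p u * (W u)\<^sup>2) * W u"
        by (simp add: W(2)[OF u] power2_eq_square power3_eq_cube)
      finally show ?thesis
        using W(1)[OF u] by simp
    qed
    then have qW: "((\<lambda>u. q u / W u) has_real_derivative H0 * p u) (at u)"
      using W(1)[OF u] by (auto intro!: derivative_eq_intros df dW u simp: power2_eq_square)
    have "((\<lambda>u. H0 * (f2 u - a * u)) has_real_derivative H0 * p u) (at u)"
      by (auto intro!: derivative_eq_intros df u)
    from DERIV_diff[OF qW this]
    have "((\<lambda>u. q u / W u - H0 * (f2 u - a * u)) has_real_derivative 0) (at u)"
      by simp
    then show "((\<lambda>u. q u / W u - H0 * (f2 u - a * u)) has_real_derivative 0) (at u within U)"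
      by (rule has_field_derivative_at_within)
  qed
  then obtain K where K: "\<And>u. u \<in> U \<Longrightarrow> q u / W u - H0 * (f2 u - a * u) = K" by blast
  \<comment> \<open>The constant of integration is absorbed as the shift \<open>K / H0\<close> of
    f2. It comes from all of \<open>U\<close>, so one shift serves every \<open>J\<close>.\<close>
  define F where "F = (\<lambda>u. f2 u + K / H0 - a * u)"
  have F: "q u = H0 * F u * W u" if "u \<in> U" for u
  proof -
    have "H0 * F u = q u / W u"
      using K[OF that, symmetric] \<open>H0 \<noteq> 0\<close> by (simp add: F_def algebra_simps)
    then show ?thesis
      using W(1)[OF that] by simp
  qed
  have dF: "(F has_real_derivative p u) (at u)" if "u \<in> U" for u
    unfolding F_def by (auto intro!: derivative_eq_intros df that)
  \<comment> \<open>With \<sigma> = \<open>q / p\<close>, the square of \<open>W / p\<close> is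
    \<open>1 + \<sigma>^2\<close>, so \<sigma>\<sigma>' equals \<open>W / p\<close> times its
    derivative. As \<open>F\<close> equals \<sigma> divided by \<open>H0 * (W / p)\<close>, an
    antiderivative of F\<sigma>' is \<open>W / (H0 * p)\<close>.\<close>
  define \<zeta> where "\<zeta> = (\<lambda>u. W u / (H0 * p u))"
  \<comment> \<open>The desired formula for f1, solved for its integral term. The formula then holds
    by construction, and what remains is the derivative of \<open>P\<close>.\<close>
  define P where "P = (\<lambda>u. (F u)\<^sup>2 * \<zeta> u - 2 / H0\<^sup>2 * (f1 u - c * u))"
  have d\<zeta>: "(\<zeta> has_real_derivative F u * deriv (\<lambda>u. q u / p u) u) (at u)"
    if u: "u \<in> U" "p u \<noteq> 0" for u
  proof -
    have "((\<lambda>u. q u / p u) has_real_derivative (q' u * p u - q u * p' u) / (p u * p u)) (at u)"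
      using u by (auto intro!: derivative_eq_intros df)
    then have \<sigma>: "deriv (\<lambda>u. q u / p u) u = (q' u * p u - q u * p' u) / (p u * p u)"
      by (rule DERIV_imp_deriv)
    have "(\<zeta> has_real_derivative
        ((p u * p' u + q u * q' u) / W u * (H0 * p u) - W u * (H0 * p' u)) / (H0 * p u * (H0 * p u))) (at u)"
      unfolding \<zeta>_def using u \<open>H0 \<noteq> 0\<close> by (auto intro!: derivative_eq_intros df dW)
    also have "((p u * p' u + q u * q' u) / W u * (H0 * p u) - W u * (H0 * p' u)) / (H0 * p u * (H0 * p u))
        = ((p u * p' u + q u * q' u) * p u - (W u)\<^sup>2 * p' u) / (H0 * W u * (p u * p u))"
      using u \<open>H0 \<noteq> 0\<close> W(1)[OF u(1)] by (simp add: field_simps power2_eq_square)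
    also have "(p u * p' u + q u * q' u) * p u - (W u)\<^sup>2 * p' u = q u * (q' u * p u - q u * p' u)"
      unfolding W2 by (simp add: power2_eq_square algebra_simps)
    also have "q u * (q' u * p u - q u * p' u) / (H0 * W u * (p u * p u))
        = F u * ((q' u * p u - q u * p' u) / (p u * p u))"
      using \<open>H0 \<noteq> 0\<close> W(1)[OF u(1)] by (simp add: F[OF u(1)])
    finally show ?thesis by (simp add: \<sigma>)
  qed
  have dP: "(P has_real_derivative (F u)\<^sup>2 * deriv \<zeta> u) (at u)" if u: "u \<in> U" "p u \<noteq> 0" for u
  proof -
    have "(\<zeta> has_real_derivative deriv \<zeta> u) (at u)"
      using d\<zeta>[OF u] DERIV_imp_deriv[OF d\<zeta>[OF u]] by simp
    then have "(P has_real_derivative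
        2 * F u * p u * \<zeta> u + (F u)\<^sup>2 * deriv \<zeta> u - 2 / H0\<^sup>2 * q u) (at u)"
      unfolding P_def using \<open>H0 \<noteq> 0\<close> by (auto intro!: derivative_eq_intros df dF u simp: power2_eq_square power4_eq_xxxx)
    \<comment> \<open>The product rule leaves this term beyond \<open>F^2\<close> times \<zeta>'. It
      cancels against the derivative of the f1 part because \<open>q = H0 * F * W\<close> and
      \<open>W = H0 * p * \<zeta>\<close>.\<close>
    moreover have "2 * F u * p u * \<zeta> u = 2 / H0\<^sup>2 * q u"
      using \<open>H0 \<noteq> 0\<close> u(2) by (simp add: F[OF u(1)] \<zeta>_def power2_eq_square)
    ultimately show ?thesis by simp
  qed
  have "\<forall>J. is_interval J \<and> J \<subseteq> U \<and> (\<forall>u\<in>J. deriv f2 u \<noteq> a) \<longrightarrow>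
      (let F = (\<lambda>u. f2 u + K / H0 - a * u); \<sigma> = (\<lambda>u. (deriv f1 u - c) / (deriv f2 u - a))
       in \<exists>\<zeta> P. antiderivative_on J \<zeta> (\<lambda>u. F u * deriv \<sigma> u) \<and>
          antiderivative_on J P (\<lambda>u. (F u)\<^sup>2 * deriv \<zeta> u) \<and>
          (\<forall>u\<in>J. f1 u + 0 = c * u + H0\<^sup>2 * (1 / 2 * (F u)\<^sup>2 * \<zeta> u - 1 / 2 * P u)))"
  proof (intro allI impI)
    fix J assume J: "is_interval J \<and> J \<subseteq> U \<and> (\<forall>u\<in>J. deriv f2 u \<noteq> a)"
    have "antiderivative_on J \<zeta> (\<lambda>u. F u * deriv (\<lambda>u. q u / p u) u)"
      unfolding antiderivative_on_def using J d\<zeta> by (auto simp: p_def)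
    moreover have "antiderivative_on J P (\<lambda>u. (F u)\<^sup>2 * deriv \<zeta> u)"
      unfolding antiderivative_on_def using J dP by (auto simp: p_def)
    moreover have "f1 u + 0 = c * u + H0\<^sup>2 * (1 / 2 * (F u)\<^sup>2 * \<zeta> u - 1 / 2 * P u)" for u
      using \<open>H0 \<noteq> 0\<close> by (simp add: P_def field_simps)
    ultimately show "let F = (\<lambda>u. f2 u + K / H0 - a * u); \<sigma> = (\<lambda>u. (deriv f1 u - c) / (deriv f2 u - a))
       in \<exists>\<zeta> P. antiderivative_on J \<zeta> (\<lambda>u. F u * deriv \<sigma> u) \<and>
          antiderivative_on J P (\<lambda>u. (F u)\<^sup>2 * deriv \<zeta> u) \<and>
          (\<forall>u\<in>J. f1 u + 0 = c * u + H0\<^sup>2 * (1 / 2 * (F u)\<^sup>2 * \<zeta> u - 1 / 2 * P u))"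
      unfolding Let_def F_def p_def q_def by blast
  qed
  ultimately show ?thesis by blast
qed

end
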